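(* Let $S\ltimes_\phi G$ be a semi-direct product of the groups $S$ and $G$ with respect to a homomorphism $\phi:S\to\mathrm{Aut}(G)$. Let $i:u\mapsto\tilde u$ be an isomorphism from a subgroup $U$ of $G$ onto a normal subgroup $i(U)$ of $S$. The set $K=\{(\tilde u,u^{-1}) : u\in U\}$ is a normal subgroup of $S\ltimes_\phi G$ if and only if for every $u\in U$: (i) $\tilde u^{\,s}=\widetilde{u^{\phi(s)}}$ for every $s\in S$ (in particular $u^{\phi(s)}\in U$), and (ii) $g^u=g^{\phi(\tilde u)}$ for every $g\in G$.
   Context: Automorphisms act on the right; $x^t=t^{-1}xt$ denotes conjugation in a group. $S\ltimes_\phi G$ is the set of pairs $(s,g)$, $s\in S$, $g\in G$, with multiplication $(s_1,g_1)(s_2,g_2)=(s_1s_2,\,g_1^{\phi(s_2)}g_2)$. *)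

theory Defs
  imports "HOL-Algebra.Bij" "HOL-Algebra.Coset"
begin

text \<open>
  Automorphisms act on the right, so the product of \<open>\<alpha>\<close> and \<open>\<beta>\<close> in Aut(G) means
  first \<open>\<alpha>\<close>, then \<open>\<beta>\<close>. The library group \<^const>\<open>AutoGroup\<close> composes in the opposite
  order, hence the swap. An image written \<open>g\<^sup>\<alpha>\<close> in exponent notation is the
  application \<open>\<alpha> g\<close>.
\<close>

definition right_AutoGroup :: "('a, 'c) monoid_scheme \<Rightarrow> ('a \<Rightarrow> 'a) monoid" where
  "right_AutoGroup G =
     AutoGroup G \<lparr>mult := \<lambda>\<alpha> \<beta>. \<beta> \<otimes>\<^bsub>AutoGroup G\<^esub> \<alpha>\<rparr>"

definition conjugate :: "('a, 'c) monoid_scheme \<Rightarrow> 'a \<Rightarrow> 'a \<Rightarrow> 'a" where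
  "conjugate G x t = inv\<^bsub>G\<^esub> t \<otimes>\<^bsub>G\<^esub> x \<otimes>\<^bsub>G\<^esub> t"

definition semidirect_product ::
  "('s, 'm) monoid_scheme \<Rightarrow> ('s \<Rightarrow> 'g \<Rightarrow> 'g) \<Rightarrow> ('g, 'n) monoid_scheme \<Rightarrow> ('s \<times> 'g) monoid" where
  "semidirect_product S \<phi> G =
     \<lparr>carrier = carrier S \<times> carrier G,
      mult = \<lambda>(s1, g1) (s2, g2). (s1 \<otimes>\<^bsub>S\<^esub> s2, \<phi> s2 g1 \<otimes>\<^bsub>G\<^esub> g2),
      one = (\<one>\<^bsub>S\<^esub>, \<one>\<^bsub>G\<^esub>)\<rparr>"

lemma carrier_right_AutoGroup: "carrier (right_AutoGroup G) = auto G"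
  by (simp add: right_AutoGroup_def AutoGroup_def)

lemma one_right_AutoGroup: "\<one>\<^bsub>right_AutoGroup G\<^esub> = (\<lambda>g\<in>carrier G. g)"
  by (simp add: right_AutoGroup_def AutoGroup_def BijGroup_def)

lemma mult_right_AutoGroup:
  assumes "\<alpha> \<in> auto G" "\<beta> \<in> auto G" "g \<in> carrier G"
  shows "(\<alpha> \<otimes>\<^bsub>right_AutoGroup G\<^esub> \<beta>) g = \<beta> (\<alpha> g)"
  using assms
  by (simp add: right_AutoGroup_def AutoGroup_def BijGroup_def auto_def compose_def)

lemma group_right_AutoGroup:
  assumes "group G"
  shows "group (right_AutoGroup G)"
proof -
  interpret A: group "AutoGroup G"
    using assms by (rule group.AutoGroup)
  show ?thesis
  proof (rule groupI)
    fix x assume "x \<in> carrier (right_AutoGroup G)"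
    then show "\<exists>y\<in>carrier (right_AutoGroup G). y \<otimes>\<^bsub>right_AutoGroup G\<^esub> x = \<one>\<^bsub>right_AutoGroup G\<^esub>"
      by (intro bexI[of _ "inv\<^bsub>AutoGroup G\<^esub> x"]) (simp_all add: right_AutoGroup_def)
  qed (simp_all add: right_AutoGroup_def A.m_assoc)
qed

lemma group_semidirect_product:
  assumes S: "group S" and G: "group G" and \<phi>: "\<phi> \<in> hom S (right_AutoGroup G)"
  shows "group (semidirect_product S \<phi> G)"
proof -
  interpret S: group S by (rule S)
  interpret G: group G by (rule G)
  have \<phi>_auto: "\<phi> s \<in> auto G" if "s \<in> carrier S" for s
    using \<phi> that by (auto simp: hom_def carrier_right_AutoGroup)
  have closed: "\<phi> s g \<in> carrier G" if "s \<in> carrier S" "g \<in> carrier G" for s g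
    using \<phi>_auto[OF that(1)] that(2) by (auto simp: auto_def hom_def)
  have dist: "\<phi> s (g \<otimes>\<^bsub>G\<^esub> h) = \<phi> s g \<otimes>\<^bsub>G\<^esub> \<phi> s h"
    if "s \<in> carrier S" "g \<in> carrier G" "h \<in> carrier G" for s g h
    using \<phi>_auto[OF that(1)] that by (auto simp: auto_def hom_def)
  have act: "\<phi> (s \<otimes>\<^bsub>S\<^esub> t) g = \<phi> t (\<phi> s g)"
    if "s \<in> carrier S" "t \<in> carrier S" "g \<in> carrier G" for s t g
    using \<phi> that by (simp add: hom_def \<phi>_auto mult_right_AutoGroup)
  have \<phi>_one: "\<phi> \<one>\<^bsub>S\<^esub> g = g" if "g \<in> carrier G" for g
    using hom_one[OF \<phi> S group_right_AutoGroup[OF G]] that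
    by (simp add: one_right_AutoGroup)
  have one: "\<phi> s \<one>\<^bsub>G\<^esub> = \<one>\<^bsub>G\<^esub>" if "s \<in> carrier S" for s
    using hom_one[of "\<phi> s" G G] \<phi>_auto[OF that] G by (simp add: auto_def)
  show ?thesis
  proof (rule groupI)
    fix x assume "x \<in> carrier (semidirect_product S \<phi> G)"
    then obtain s g where x: "x = (s, g)" "s \<in> carrier S" "g \<in> carrier G"
      by (auto simp: semidirect_product_def)
    have "\<phi> s (\<phi> (inv\<^bsub>S\<^esub> s) (inv\<^bsub>G\<^esub> g)) \<otimes>\<^bsub>G\<^esub> g = \<one>\<^bsub>G\<^esub>"
      using x by (simp add: act[symmetric] \<phi>_one)
    then show "\<exists>y\<in>carrier (semidirect_product S \<phi> G).
        y \<otimes>\<^bsub>semidirect_product S \<phi> G\<^esub> x = \<one>\<^bsub>semidirect_product S \<phi> G\<^esub>"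
      using x
      by (intro bexI[of _ "(inv\<^bsub>S\<^esub> s, \<phi> (inv\<^bsub>S\<^esub> s) (inv\<^bsub>G\<^esub> g))"])
        (auto simp: semidirect_product_def closed)
  qed (auto simp: semidirect_product_def closed dist act \<phi>_one one S.m_assoc G.m_assoc)
qed

end

theory Submission
  imports Defs
begin

text \<open>
  Normality is tested by comparing \<open>k x\<close> with \<open>x k'\<close>, so that no inverse in the semidirect
  product is needed. For \<open>k = (i(u), u\<^sup>-\<^sup>1)\<close> and \<open>x = (s, g)\<close> this compares
  \<open>(i(u) s, (\<phi>(s)(u))\<^sup>-\<^sup>1 g)\<close> with \<open>(s i(v), \<phi>(i(v))(g) v\<^sup>-\<^sup>1)\<close>; the choice \<open>g = 1\<close> yields (i), the
  choice \<open>s = 1\<close> yields (ii), and conversely \<open>v = \<phi>(s)(u)\<close> works in general.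
\<close>

lemma (in group) normal_iff_commute:
  "N \<lhd> G \<longleftrightarrow> subgroup N G \<and> (\<forall>x\<in>carrier G. \<forall>h\<in>N. \<exists>h'\<in>N. h \<otimes> x = x \<otimes> h')"
proof safe
  assume N: "N \<lhd> G"
  then show "subgroup N G" by (rule normal_imp_subgroup)
  fix x h assume x: "x \<in> carrier G" and h: "h \<in> N"
  have "h \<otimes> x \<in> x <# N"
    using normal.coset_eq[OF N] x h by (auto simp: r_coset_def)
  then show "\<exists>h'\<in>N. h \<otimes> x = x \<otimes> h'" by (auto simp: l_coset_def)
next
  assume N: "subgroup N G"
    and comm: "\<forall>x\<in>carrier G. \<forall>h\<in>N. \<exists>h'\<in>N. h \<otimes> x = x \<otimes> h'"
  have "x \<otimes> h \<otimes> inv x \<in> N" if x: "x \<in> carrier G" and h: "h \<in> N" for x h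
  proof -
    \<comment> \<open>\<open>normal_inv_iff\<close> conjugates as
      \<open>x h x\<^sup>-\<^sup>1\<close>, so the commutation hypothesis is applied to
      \<open>inv x\<close>.\<close>
    obtain h' where h': "h' \<in> N" "h \<otimes> inv x = inv x \<otimes> h'"
      using comm x h by (meson inv_closed)
    have "x \<otimes> h \<otimes> inv x = x \<otimes> (inv x \<otimes> h')"
      using x h h' subgroup.mem_carrier[OF N] by (simp add: m_assoc)
    also have "\<dots> = h'"
      using x h' subgroup.mem_carrier[OF N] by (simp flip: m_assoc)
    finally show ?thesis using h' by simp
  qed
  with N show "N \<lhd> G" by (simp add: normal_inv_iff)
qed

text \<open>Clears the inverse from (i), which then has the form of an equality of first components
  in the comparison.\<close>

lemma (in group) conjugate_eq_iff:
  assumes "x \<in> carrier G" "t \<in> carrier G" "y \<in> carrier G"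
  shows "conjugate G x t = y \<longleftrightarrow> x \<otimes> t = t \<otimes> y"
  using assms by (simp add: conjugate_def m_assoc inv_solve_left')

lemma group_hom_right_AutoGroup:
  assumes "group G" "\<phi> \<in> hom S (right_AutoGroup G)" "s \<in> carrier S"
  shows "group_hom G G (\<phi> s)"
  using assms
  by (auto simp: hom_def carrier_right_AutoGroup auto_def group_hom_def group_hom_axioms_def)

text \<open>The unit of \<open>right_AutoGroup G\<close> is the identity restricted to the carrier,
  so \<open>g\<close> must lie in \<open>carrier G\<close>.\<close>

lemma hom_right_AutoGroup_one:
  assumes "group S" "group G" "\<phi> \<in> hom S (right_AutoGroup G)" "g \<in> carrier G"
  shows "\<phi> \<one>\<^bsub>S\<^esub> g = g"
  using hom_one[OF assms(3,1) group_right_AutoGroup[OF assms(2)]] assms(4)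
  by (simp add: one_right_AutoGroup)

lemma carrier_semidirect_product:
  "carrier (semidirect_product S \<phi> G) = carrier S \<times> carrier G"
  by (simp add: semidirect_product_def)

lemma mult_semidirect_product:
  "(s, g) \<otimes>\<^bsub>semidirect_product S \<phi> G\<^esub> (t, h) = (s \<otimes>\<^bsub>S\<^esub> t, \<phi> t g \<otimes>\<^bsub>G\<^esub> h)"
  by (simp add: semidirect_product_def)

theorem proposition3p1p1:
  fixes S :: "('s, 'm) monoid_scheme"
    and G :: "('g, 'n) monoid_scheme"
    and \<phi> :: "'s \<Rightarrow> 'g \<Rightarrow> 'g"
    and U :: "'g set"
    and i :: "'g \<Rightarrow> 's"
  assumes "group S"
    and "group G"
    and "\<phi> \<in> hom S (right_AutoGroup G)"
    and "subgroup U G"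
    and "i ` U \<lhd> S"
    and "i \<in> iso (G\<lparr>carrier := U\<rparr>) (S\<lparr>carrier := i ` U\<rparr>)"
  shows "{(i u, inv\<^bsub>G\<^esub> u) | u. u \<in> U} \<lhd> semidirect_product S \<phi> G \<longleftrightarrow>
    (\<forall>u\<in>U.
      (\<forall>s\<in>carrier S. \<phi> s u \<in> U \<and> conjugate S (i u) s = i (\<phi> s u)) \<and>
      (\<forall>g\<in>carrier G. conjugate G g u = \<phi> (i u) g))"
proof -
  interpret S: group S by fact
  interpret G: group G by fact
  interpret U: subgroup U G by fact
  let ?D = "semidirect_product S \<phi> G"
  define K where "K = {(i u, inv\<^bsub>G\<^esub> u) | u. u \<in> U}"
  interpret D: group ?D
    by (rule group_semidirect_product) fact+
  note \<phi>_hom = group_hom_right_AutoGroup[OF assms(2,3)]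
  note \<phi>_closed = group_hom.hom_closed[OF \<phi>_hom]
  note \<phi>_inv = group_hom.hom_inv[OF \<phi>_hom]
  note \<phi>_one = group_hom.hom_one[OF \<phi>_hom]
  note \<phi>_id = hom_right_AutoGroup_one[OF assms(1-3)]
  have i_closed: "i u \<in> carrier S" if "u \<in> U" for u
    using normal_imp_subgroup[OF assms(5)] that by (auto dest: subgroup.subset)
  have i_mult: "i (u \<otimes>\<^bsub>G\<^esub> v) = i u \<otimes>\<^bsub>S\<^esub> i v" if "u \<in> U" "v \<in> U" for u v
    using assms(6) that by (auto simp: iso_def hom_def)
  note closed = i_closed U.mem_carrier U.m_closed U.m_inv_closed
  \<comment> \<open>By multiplicativity \<open>i 1\<close> is idempotent in the group
    \<open>S\<close>, hence trivial by cancellation.\<close>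
  have i_one: "i \<one>\<^bsub>G\<^esub> = \<one>\<^bsub>S\<^esub>"
    using i_mult[of "\<one>\<^bsub>G\<^esub>" "\<one>\<^bsub>G\<^esub>"] i_closed[of "\<one>\<^bsub>G\<^esub>"] by simp
  have K_mem: "(i u, inv\<^bsub>G\<^esub> u) \<in> K" if "u \<in> U" for u
    using that by (auto simp: K_def)
  have "K \<lhd> ?D \<longleftrightarrow>
    (\<forall>u\<in>U.
      (\<forall>s\<in>carrier S. \<phi> s u \<in> U \<and> conjugate S (i u) s = i (\<phi> s u)) \<and>
      (\<forall>g\<in>carrier G. conjugate G g u = \<phi> (i u) g))" (is "_ \<longleftrightarrow> ?R")
  proof
    assume "K \<lhd> ?D"
    then have comm: "\<exists>v\<in>U. (i u, inv\<^bsub>G\<^esub> u) \<otimes>\<^bsub>?D\<^esub> (s, g) = (s, g) \<otimes>\<^bsub>?D\<^esub> (i v, inv\<^bsub>G\<^esub> v)"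
      if "u \<in> U" "s \<in> carrier S" "g \<in> carrier G" for u s g
      using that K_mem unfolding D.normal_iff_commute carrier_semidirect_product
      by (fastforce simp: K_def)
    show ?R
    proof (intro ballI conjI)
      fix u s assume u: "u \<in> U" and s: "s \<in> carrier S"
      obtain v where v: "v \<in> U" "i u \<otimes>\<^bsub>S\<^esub> s = s \<otimes>\<^bsub>S\<^esub> i v" "inv\<^bsub>G\<^esub> (\<phi> s u) = inv\<^bsub>G\<^esub> v"
        using comm[OF u s G.one_closed] u s
        by (auto simp: mult_semidirect_product \<phi>_closed \<phi>_inv \<phi>_one closed)
      \<comment> \<open>The second components determine \<open>v\<close>; the first components then
        give the conjugation formula.\<close>
      have "\<phi> s u = v"
        using v u s by (metis G.inv_inv U.mem_carrier \<phi>_closed)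
      then show "\<phi> s u \<in> U" "conjugate S (i u) s = i (\<phi> s u)"
        using u s v by (auto simp: S.conjugate_eq_iff closed)
    next
      fix u g assume u: "u \<in> U" and g: "g \<in> carrier G"
      obtain v where v: "v \<in> U" "i u = i v" "inv\<^bsub>G\<^esub> u \<otimes>\<^bsub>G\<^esub> g = \<phi> (i v) g \<otimes>\<^bsub>G\<^esub> inv\<^bsub>G\<^esub> v"
        using comm[OF u S.one_closed g] u g
        by (auto simp: mult_semidirect_product \<phi>_id closed)
      \<comment> \<open>At \<open>s = 1\<close> the first components read \<open>i u = i v\<close>,
        and \<open>i\<close> is injective on \<open>U\<close>.\<close>
      have "u = v"
        using assms(6) u v by (auto simp: iso_def bij_betw_def dest: inj_onD)
      then show "conjugate G g u = \<phi> (i u) g"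
        using v u g by (simp add: conjugate_def closed \<phi>_closed G.inv_solve_right)
    qed
  next
    assume R: ?R
    have act: "\<phi> (i u) g = conjugate G g u" if "u \<in> U" "g \<in> carrier G" for u g
      using R that by simp
    have act': "\<phi> s u \<in> U" "i u \<otimes>\<^bsub>S\<^esub> s = s \<otimes>\<^bsub>S\<^esub> i (\<phi> s u)" if "u \<in> U" "s \<in> carrier S" for u s
      using R that S.conjugate_eq_iff[of "i u" s "i (\<phi> s u)"] by (simp_all add: closed)
    \<comment> \<open>So \<open>u \<mapsto> (i u, u\<^sup>-\<^sup>1)\<close> is multiplicative: by
      (ii) the second component is \<open>(v\<^sup>-\<^sup>1 u\<^sup>-\<^sup>1 v) v\<^sup>-\<^sup>1
      = (u v)\<^sup>-\<^sup>1\<close>.\<close>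
    have K_mult: "(i u, inv\<^bsub>G\<^esub> u) \<otimes>\<^bsub>?D\<^esub> (i v, inv\<^bsub>G\<^esub> v) = (i (u \<otimes>\<^bsub>G\<^esub> v), inv\<^bsub>G\<^esub> (u \<otimes>\<^bsub>G\<^esub> v))"
      if "u \<in> U" "v \<in> U" for u v
      using that
      by (simp add: mult_semidirect_product act conjugate_def i_mult G.m_assoc G.inv_mult_group closed)
    \<comment> \<open>The inverse of the unit stays unsimplified on the left, to match
      \<open>K_mult\<close> for the pair \<open>u\<^sup>-\<^sup>1\<close>, \<open>u\<close>.\<close>
    have one: "(i \<one>\<^bsub>G\<^esub>, inv\<^bsub>G\<^esub> \<one>\<^bsub>G\<^esub>) = \<one>\<^bsub>?D\<^esub>"
      by (simp add: i_one semidirect_product_def)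
    have K_sub: "K \<subseteq> carrier ?D"
      by (auto simp: K_def carrier_semidirect_product closed)
    have "subgroup K ?D"
    proof (rule D.subgroupI)
      show "K \<noteq> {}" using K_mem U.one_closed by blast
    next
      fix k assume "k \<in> K"
      then obtain u where u: "u \<in> U" "k = (i u, inv\<^bsub>G\<^esub> u)" by (auto simp: K_def)
      let ?k' = "(i (inv\<^bsub>G\<^esub> u), inv\<^bsub>G\<^esub> (inv\<^bsub>G\<^esub> u))"
      have k': "?k' \<in> K" using u by (intro K_mem) simp
      have "?k' \<otimes>\<^bsub>?D\<^esub> k = \<one>\<^bsub>?D\<^esub>"
        using u K_mult[of "inv\<^bsub>G\<^esub> u" u] one by (simp add: closed)
      then have "inv\<^bsub>?D\<^esub> k = ?k'"
        \<comment> \<open>In a group a left inverse is the inverse, so no formula for inverses in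
          the semidirect product is used.\<close>
        using D.inv_equality K_sub k' \<open>k \<in> K\<close> by blast
      then show "inv\<^bsub>?D\<^esub> k \<in> K" using k' by simp
    next
      fix k l assume "k \<in> K" "l \<in> K"
      then show "k \<otimes>\<^bsub>?D\<^esub> l \<in> K"
        using K_mult K_mem U.m_closed by (auto simp: K_def)
    qed (rule K_sub)
    \<comment> \<open>Put \<open>w = \<phi> s u\<close>, which lies in \<open>U\<close> by (i).
      First components agree by (i). On the right, (ii) for \<open>w\<close> gives
      \<open>(w\<^sup>-\<^sup>1 g w) w\<^sup>-\<^sup>1 = w\<^sup>-\<^sup>1 g\<close>, which is the
      second component on the left.\<close>
    moreover have "(i u, inv\<^bsub>G\<^esub> u) \<otimes>\<^bsub>?D\<^esub> (s, g) = (s, g) \<otimes>\<^bsub>?D\<^esub> (i (\<phi> s u), inv\<^bsub>G\<^esub> (\<phi> s u))"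
      if "u \<in> U" "s \<in> carrier S" "g \<in> carrier G" for u s g
      using that act'
      by (simp add: mult_semidirect_product act conjugate_def \<phi>_inv \<phi>_closed G.m_assoc closed)
    ultimately show "K \<lhd> ?D"
      unfolding D.normal_iff_commute carrier_semidirect_product
      using K_mem act'(1) by (fastforce simp: K_def)
  qed
  then show ?thesis by (simp only: K_def)
qed

end
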